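(* Let $s, t > 1$ be relatively prime odd positive integers. (1) If $s \equiv 3 \pmod 4$ and $t \equiv 3 \pmod 4$, then the number of even $(\bar{s}, \bar{t})$-core partitions is $$\frac{1}{2}\binom{\frac{s-1}{2} + \frac{t-1}{2}}{\frac{s-1}{2}}.$$ (2) Otherwise (i.e. if at least one of $s,t$ is congruent to $1$ modulo $4$), the number of even $(\bar{s}, \bar{t})$-core partitions is $$\frac{1}{2}\left( \binom{\frac{s-1}{2} + \frac{t-1}{2}}{\frac{s-1}{2}} + (-1)^{(s-1)(t-1)/8} \left(\frac{s}{t}\right)\binom{\lfloor s/4\rfloor + \lfloor t/4 \rfloor}{\lfloor t/4 \rfloor} \right),$$ where $\left(\frac{s}{t}\right)$ denotes the Jacobi symbol.
   Context: A bar partition is a partition $\lambda = (\lambda_1, \ldots, \lambda_k)$ into distinct positive parts $\lambda_1 > \cdots > \lambda_k$; it is identified with the finite set of its parts, and the empty partition is allowed. Partitions of all sizes are counted. For an odd integer $s>1$, a bar partition $\lambda$ is an $\bar{s}$-core partition if and only if the following three conditions hold: (i) no part of $\lambda$ is divisible by $s$; (ii) for every part $a \in \lambda$ with $a > s$, also $a - s \in \lambda$; (iii) for every part $a\in\lambda$ with $1 \le a \le s-1$, $s - a \notin \lambda$. An $(\bar{s},\bar{t})$-core partition is a bar partition that is both an $\bar{s}$-core partition and a $\bar{t}$-core partition. A partition is called even if it has an even number of even parts (equivalently, its size minus its number of parts is even). *)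

theory Defs
  imports "HOL-Number_Theory.Number_Theory"
begin

text \<open>
  A bar partition (a partition into distinct positive parts) is represented by the finite
  set of its parts; the empty set is the empty partition.
\<close>

definition bar_partition :: "nat set \<Rightarrow> bool" where
  "bar_partition L \<longleftrightarrow> finite L \<and> (\<forall>a\<in>L. a > 0)"

text \<open>The combinatorial description of bar cores; it is meant for odd \<open>s > 1\<close>.\<close>

definition bar_core :: "nat \<Rightarrow> nat set \<Rightarrow> bool" where
  "bar_core s L \<longleftrightarrow> bar_partition L \<and>
     (\<forall>a\<in>L. \<not> s dvd a) \<and>
     (\<forall>a\<in>L. a > s \<longrightarrow> a - s \<in> L) \<and>
     (\<forall>a\<in>L. 1 \<le> a \<and> a \<le> s - 1 \<longrightarrow> s - a \<notin> L)"

definition even_partition :: "nat set \<Rightarrow> bool" where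
  "even_partition L \<longleftrightarrow> even (card {a\<in>L. even a})"

text \<open>
  The Jacobi symbol of \<open>a\<close> over \<open>n\<close>, for odd positive \<open>n\<close>: the product of the
  Legendre symbols over the prime factors of \<open>n\<close>, with multiplicity.
\<close>

definition Jacobi :: "int \<Rightarrow> nat \<Rightarrow> int" where
  "Jacobi a n = (\<Prod>p\<in>#prime_factorization n. Legendre a (int p))"

end

theory Submission
  imports Defs
begin

text \<open>
  Write \<open>m = (s - 1) / 2\<close> and \<open>n = (t - 1) / 2\<close>.  A bar partition \<open>L\<close> is encoded by the set of
  integers containing \<open>0\<close>, the parts of \<open>L\<close>, and the negatives of the positive integers that are
  not parts.  If \<open>L\<close> is a bar core for \<open>s\<close>, then this set is closed under subtracting \<open>s\<close>.
  Since \<open>s\<close> and \<open>t\<close> are coprime, every integer has the form \<open>i t - j s\<close>, and by antisymmetry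
  a simultaneous core is determined by the values \<open>i t - j s\<close> with \<open>1 \<le> i \<le> m\<close> and
  \<open>1 \<le> j \<le> n\<close>.  The closure conditions say that the cells \<open>(i, j)\<close> whose value belongs to the set
  form a staircase in an \<open>m \<times> n\<close> box.  Hence simultaneous cores correspond to
  staircases (\<open>bar_cores_eq\<close>, \<open>inj_on_bar_of\<close>), and there are \<open>m + n choose m\<close> of them.

  The parts of the core belonging to the staircase \<open>D\<close> are the numbers \<open>\<bar>i t - j s\<bar>\<close> over the
  symmetric difference of \<open>D\<close> and the set \<open>N\<close> of cells with \<open>i t < j s\<close>; such a part is even
  iff \<open>i + j\<close> is even.  So the sign \<open>(-1)\<close> to the number of even parts is the product of a
  sign depending on \<open>D\<close> alone and a sign depending on \<open>s\<close> and \<open>t\<close> alone, and the difference between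
  the numbers of even and odd cores splits into two factors.

  The first factor is the sum over all staircases \<open>D\<close> of \<open>(-1)\<close> to the number of cells of \<open>D\<close> with
  \<open>i + j\<close> even.  Removing the last row or column gives a Pascal-type recursion, from which
  the sum is \<open>0\<close> if \<open>m\<close> and \<open>n\<close> are odd, and otherwise, up to an explicit sign, the binomial
  coefficient of the halves of \<open>m\<close> and \<open>n\<close>, rounded down (\<open>staircase_sum_chess_sign\<close>).  Behind this is a
  cancellation: group the steps of the boundary path into consecutive pairs, from the cell \<open>(1, 1)\<close> on;
  exchanging the two steps of a pair changes the sign, and only the paths made of doubled steps survive,
  with a single last step if \<open>m + n\<close> is odd.

  The second factor is \<open>(-1)\<close> to the number of cells of \<open>N\<close> with \<open>i + j\<close> even.  As in
  Eisenstein's form of Gauss's lemma, it is the Jacobi symbol of \<open>s\<close> over \<open>t\<close> up to an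
  explicit sign (\<open>minus_one_power_even_neg\<close>).  The count changes in a controlled way
  under \<open>s \<mapsto> s + 2 t\<close>, under \<open>s \<mapsto> 2 t - s\<close>, and under exchanging \<open>s\<close> and \<open>t\<close>; the
  Jacobi symbol obeys matching rules, namely periodicity, the value at \<open>-1\<close>, and reciprocity.  These
  moves reduce every coprime pair of odd numbers to \<open>(1, 1)\<close>.
\<close>

section \<open>The Jacobi symbol\<close>

lemma minus_one_power_cong:
  assumes "even a \<longleftrightarrow> even b"
  shows "(-1::'a::ring_1) ^ a = (-1) ^ b"
  using assms by (simp add: minus_one_power_iff)

lemma Legendre_cong:
  assumes "[a = b] (mod p)"
  shows "Legendre a p = Legendre b p"
proof -
  have "QuadRes p a = QuadRes p b"
    unfolding QuadRes_def using assms cong_sym cong_trans by blast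
  moreover have "[a = 0] (mod p) = [b = 0] (mod p)"
    using assms cong_sym cong_trans by blast
  ultimately show ?thesis by (simp add: Legendre_def)
qed

lemma Legendre_range: "Legendre a p \<in> {-1, 0, 1}"
  by (auto simp: Legendre_def)

lemma eq_if_cong_mod_gt_2:
  fixes x y :: int
  assumes "[x = y] (mod p)" "p > 2" "\<bar>x\<bar> \<le> 1" "\<bar>y\<bar> \<le> 1"
  shows "x = y"
proof (rule ccontr)
  assume "x \<noteq> y"
  moreover have "p dvd x - y"
    using assms(1) by (simp add: cong_iff_dvd_diff)
  ultimately have "\<bar>p\<bar> \<le> \<bar>x - y\<bar>"
    by (intro dvd_imp_le_int) auto
  then show False using assms by linarith
qed

text \<open>
  By Euler's criterion the symbol is a power of its argument modulo \<open>p\<close>, and powers are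
  multiplicative; values in \<open>{-1, 0, 1}\<close> that agree modulo \<open>p > 2\<close> are equal.
\<close>

lemma Legendre_mult:
  assumes "prime p" "odd p"
  shows "Legendre (a * b) (int p) = Legendre a (int p) * Legendre b (int p)"
proof -
  have p: "2 < p"
    using assms prime_ge_2_nat[of p] by (cases "p = 2") auto
  have E: "[Legendre c (int p) = c ^ ((p - 1) div 2)] (mod int p)" for c
    using euler_criterion[OF assms(1) p] .
  have "[Legendre (a * b) (int p) = Legendre a (int p) * Legendre b (int p)] (mod int p)"
    using E[of "a * b"] cong_mult[OF E[of a] E[of b]]
    by (metis cong_sym cong_trans power_mult_distrib)
  then show ?thesis
    using Legendre_range[of "a * b" "int p"] Legendre_range[of a "int p"]
      Legendre_range[of b "int p"] p
    by (intro eq_if_cong_mod_gt_2) auto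
qed

lemma Legendre_minus_one:
  assumes "prime p" "odd p"
  shows "Legendre (-1) (int p) = (-1) ^ (p div 2)"
proof -
  have p: "2 < p"
    using assms prime_ge_2_nat[of p] by (cases "p = 2") auto
  have "[Legendre (-1) (int p) = (-1) ^ ((p - 1) div 2)] (mod int p)"
    using euler_criterion[OF assms(1) p] .
  moreover have "(p - 1) div 2 = p div 2" using \<open>odd p\<close> by presburger
  ultimately show ?thesis
    using Legendre_range[of "-1" "int p"] p
    by (intro eq_if_cong_mod_gt_2[of _ _ "int p"]) (auto simp: power_abs)
qed

lemma Jacobi_1_right [simp]: "Jacobi a (Suc 0) = 1"
  by (simp add: Jacobi_def)

lemma Jacobi_prime:
  assumes "prime p"
  shows "Jacobi a p = Legendre a (int p)"
  using assms by (simp add: Jacobi_def prime_factorization_prime)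

lemma Jacobi_mult_right:
  assumes "b > 0" "c > 0"
  shows "Jacobi a (b * c) = Jacobi a b * Jacobi a c"
  using assms by (simp add: Jacobi_def prime_factorization_mult)

lemma Jacobi_cong:
  assumes "[a = b] (mod int n)"
  shows "Jacobi a n = Jacobi b n"
proof -
  have "Legendre a (int p) = Legendre b (int p)" if "p \<in># prime_factorization n" for p
    using that assms by (intro Legendre_cong cong_dvd_modulus[OF assms]) (auto dest: in_prime_factors_imp_dvd)
  then show ?thesis
    unfolding Jacobi_def by (intro arg_cong[of _ _ prod_mset] image_mset_cong) auto
qed

lemma odd_if_in_prime_factorization:
  assumes "odd n" "p \<in># prime_factorization n"
  shows "prime p \<and> odd p"
  using assms by (meson dvd_trans in_prime_factors_imp_dvd in_prime_factors_imp_prime)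

lemma Jacobi_mult_left:
  assumes "odd n"
  shows "Jacobi (a * b) n = Jacobi a n * Jacobi b n"
proof -
  have "Jacobi (a * b) n =
      (\<Prod>p\<in>#prime_factorization n. Legendre a (int p) * Legendre b (int p))"
    unfolding Jacobi_def using odd_if_in_prime_factorization[OF assms]
    by (intro arg_cong[of _ _ prod_mset] image_mset_cong) (simp add: Legendre_mult)
  then show ?thesis by (simp add: Jacobi_def prod_mset.distrib)
qed

lemma Jacobi_1_left [simp]: "Jacobi 1 n = 1"
proof -
  have "Legendre 1 (int p) = 1" if "p \<in># prime_factorization n" for p
  proof -
    have "QuadRes (int p) 1" unfolding QuadRes_def by (rule exI[of _ 1]) simp
    moreover have "\<not> [1 = 0] (mod int p)"
      using in_prime_factors_imp_prime[OF that] prime_gt_1_nat[of p]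
      by (auto simp: cong_iff_dvd_diff)
    ultimately show ?thesis by (simp add: Legendre_def)
  qed
  then have "Jacobi 1 n = (\<Prod>p\<in>#prime_factorization n. 1)"
    unfolding Jacobi_def by (intro arg_cong[of _ _ prod_mset] image_mset_cong) auto
  then show ?thesis by simp
qed

text \<open>
  Modulo 2, the map \<open>n \<mapsto> (n - 1) / 2\<close> turns products of odd numbers into sums.
\<close>

lemma minus_one_power_half_mult:
  assumes "odd (a::nat)" "odd b"
  shows "(-1::int) ^ (a * b div 2 * k) = (-1) ^ (a div 2 * k) * (-1) ^ (b div 2 * k)"
proof -
  obtain c d where "a = 2 * c + 1" "b = 2 * d + 1" using assms by (elim oddE)
  then have "a * b div 2 = 2 * (c * d) + (c + d)" "a div 2 = c" "b div 2 = d"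
    by (auto simp: algebra_simps)
  then show ?thesis
    by (simp add: power_mult power_add power_mult_distrib)
qed

lemma odd_nat_induct [consumes 1, case_names one prime_mult]:
  fixes n :: nat
  assumes "odd n" "P 1"
    and "\<And>p n. prime p \<Longrightarrow> odd p \<Longrightarrow> odd n \<Longrightarrow> P n \<Longrightarrow> P (p * n)"
  shows "P n"
  using assms(1)
proof (induction n rule: prime_divisors_induct)
  case zero
  then show ?case by simp
next
  case (unit x)
  then show ?case using assms(2) by simp
next
  case (factor p x)
  then show ?case using assms(3) by simp
qed

lemma Jacobi_minus_one:
  assumes "odd n"
  shows "Jacobi (-1) n = (-1) ^ (n div 2)"
  using assms
proof (induction n rule: odd_nat_induct)
  case one
  then show ?case by simp
next
  case (prime_mult p n)
  then show ?case
    using Jacobi_mult_right[of p n "-1"] minus_one_power_half_mult[of p n 1]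
    by (simp add: Jacobi_prime Legendre_minus_one odd_pos prime_gt_0_nat)
qed

text \<open>
  Both sides are multiplicative in \<open>m\<close> and in \<open>n\<close>, so the law reduces to the one for two distinct odd
  primes.
\<close>

theorem Jacobi_reciprocity:
  assumes "odd m" "odd n" "coprime m n"
  shows "Jacobi (int m) n * Jacobi (int n) m = (-1) ^ (m div 2 * (n div 2))"
  using assms
proof (induction m arbitrary: n rule: odd_nat_induct)
  case one
  then show ?case by simp
next
  case (prime_mult p m)
  have p: "Jacobi (int p) n * Jacobi (int n) p = (-1) ^ (p div 2 * (n div 2))"
    if "odd n" "coprime p n" for n
    using that
  proof (induction n rule: odd_nat_induct)
    case one
    then show ?case by simp
  next
    case (prime_mult q n)
    have gt: "2 < r" if "prime r" "odd r" for r :: nat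
      using that prime_ge_2_nat[of r] by (cases "r = 2") auto
    have "p \<noteq> q" using prime_mult.prems \<open>prime p\<close> by auto
    then have L: "Legendre p q * Legendre q p = (-1::int) ^ (p div 2 * (q div 2))"
      using Quadratic_Reciprocity[of p q] gt \<open>prime p\<close> \<open>odd p\<close> prime_mult.hyps
      by (auto elim!: oddE)
    have IH: "Jacobi (int p) n * Jacobi (int n) p = (-1) ^ (p div 2 * (n div 2))"
      using prime_mult.prems by (intro prime_mult.IH) simp
    have "Jacobi (int p) (q * n) * Jacobi (int (q * n)) p
        = (Legendre p q * Legendre q p) * (Jacobi (int p) n * Jacobi (int n) p)"
      using prime_mult.hyps \<open>prime p\<close> \<open>odd p\<close>
      by (simp add: Jacobi_mult_right Jacobi_mult_left Jacobi_prime Legendre_mult odd_pos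
          prime_gt_0_nat)
    also have "\<dots> = (-1) ^ (p div 2 * (q * n div 2))"
      unfolding L IH mult.commute[of "p div 2"]
      using prime_mult.hyps by (intro minus_one_power_half_mult[symmetric])
    finally show ?case .
  qed
  have IH: "Jacobi (int m) n * Jacobi (int n) m = (-1) ^ (m div 2 * (n div 2))"
    using prime_mult.prems by (intro prime_mult.IH) auto
  have p: "Jacobi (int p) n * Jacobi (int n) p = (-1) ^ (p div 2 * (n div 2))"
    using prime_mult.prems by (intro p) auto
  have "Jacobi (int (p * m)) n * Jacobi (int n) (p * m)
      = (Jacobi (int p) n * Jacobi (int n) p) * (Jacobi (int m) n * Jacobi (int n) m)"
    using prime_mult.hyps prime_mult.prems
    by (simp add: Jacobi_mult_right Jacobi_mult_left odd_pos prime_gt_0_nat)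
  also have "\<dots> = (-1) ^ (p * m div 2 * (n div 2))"
    unfolding p IH using prime_mult.hyps by (intro minus_one_power_half_mult[symmetric])
  finally show ?case .
qed

section \<open>A lattice point count\<close>

definition grid :: "nat \<Rightarrow> nat \<Rightarrow> (nat \<times> nat) set" where
  "grid m n = {1..m} \<times> {1..n}"

definition neg_cells :: "nat \<Rightarrow> nat \<Rightarrow> (nat \<times> nat) set" where
  "neg_cells s t = {(i, j) \<in> grid (s div 2) (t div 2). i * t < j * s}"

definition even_cells :: "(nat \<times> nat) set \<Rightarrow> (nat \<times> nat) set" where
  "even_cells A = {(i, j) \<in> A. even (i + j)}"

definition even_neg :: "nat \<Rightarrow> nat \<Rightarrow> nat" where
  "even_neg s t = card (even_cells (neg_cells s t))"

lemma finite_grid [simp, intro]: "finite (grid m n)"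
  by (simp add: grid_def)

lemma neg_cells_subset_grid: "neg_cells s t \<subseteq> grid (s div 2) (t div 2)"
  by (auto simp: neg_cells_def)

text \<open>
  The rectangle has odd sides, so a point on the negative side of its diagonal with \<open>j\<close> in the lower
  half also has \<open>i\<close> in the lower half.  The cells can therefore be counted row by row over all
  positive \<open>i\<close>, which makes the count easy to compare for different \<open>s\<close>.
\<close>

lemma index_bound_if_neg:
  fixes i j s t :: nat
  assumes "i * t < j * s" "j \<le> t div 2"
  shows "i \<le> s div 2"
proof -
  have "2 * i * t < 2 * j * s" using assms(1) by simp
  also have "\<dots> \<le> t * s" using assms(2) by (intro mult_right_mono) auto
  finally have "2 * i < s" by (simp add: mult.commute)
  then show ?thesis by simp
qed

definition even_neg_row :: "nat \<Rightarrow> nat \<Rightarrow> nat \<Rightarrow> nat set" where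
  "even_neg_row s t j = {i. 0 < i \<and> even (i + j) \<and> i * t < j * s}"

lemma finite_even_neg_row:
  assumes "t > 0"
  shows "finite (even_neg_row s t j)"
proof (rule finite_subset)
  show "even_neg_row s t j \<subseteq> {..<j * s}"
  proof
    fix i assume "i \<in> even_neg_row s t j"
    then have "i * t < j * s" by (simp add: even_neg_row_def)
    moreover have "i \<le> i * t" using assms by simp
    ultimately have "i < j * s" by linarith
    then show "i \<in> {..<j * s}" by simp
  qed
qed simp

lemma even_neg_eq_sum:
  assumes "t > 0"
  shows "even_neg s t = (\<Sum>j = 1..t div 2. card (even_neg_row s t j))"
proof -
  have eq: "even_cells (neg_cells s t)
      = (\<lambda>(j, i). (i, j)) ` (SIGMA j:{1..t div 2}. even_neg_row s t j)"
    by (auto simp: even_cells_def neg_cells_def grid_def even_neg_row_def Suc_le_eq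
        intro!: rev_image_eqI dest: index_bound_if_neg)
  have "even_neg s t = card (SIGMA j:{1..t div 2}. even_neg_row s t j)"
    unfolding even_neg_def eq by (rule card_image) (auto simp: inj_on_def)
  also have "\<dots> = (\<Sum>j = 1..t div 2. card (even_neg_row s t j))"
    using finite_even_neg_row[OF assms] by (intro card_SigmaI) auto
  finally show ?thesis .
qed

lemma card_same_parity_le_double:
  "card {i. 0 < i \<and> i \<le> 2 * j \<and> even (i + j)} = j"
proof -
  have "{i. 0 < i \<and> i \<le> 2 * j \<and> even (i + j)} = (\<lambda>k. 2 * k + (2 - j mod 2)) ` {..<j}"
    (is "?A = ?f ` _")
  proof (intro equalityI subsetI)
    fix i assume "i \<in> ?A"
    then have "i = ?f ((i - 1) div 2)" "(i - 1) div 2 < j" by (auto; presburger)+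
    then show "i \<in> ?f ` {..<j}" by blast
  next
    fix i assume "i \<in> ?f ` {..<j}"
    then show "i \<in> ?A" by (auto; presburger)
  qed
  moreover have "inj_on (\<lambda>k. 2 * k + (2 - j mod 2)) {..<j}"
    by (simp only: inj_on_def add_right_cancel) simp
  ultimately show ?thesis by (metis card_image card_lessThan)
qed

text \<open>
  When \<open>s\<close> grows by \<open>2 t\<close>, the line \<open>i t = j s\<close> moves in row \<open>j\<close> to the right by \<open>2 j\<close>, an even shift that preserves the
  parity condition and uncovers \<open>j\<close> further points.
\<close>

lemma even_neg_add_double:
  assumes "s > 0" "t > 0"
  shows "even_neg (s + 2 * t) t = even_neg s t + (\<Sum>j = 1..t div 2. j)"
proof -
  have "card (even_neg_row (s + 2 * t) t j) = card (even_neg_row s t j) + j" if "j \<ge> 1" for j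
  proof -
    let ?A = "{i. 0 < i \<and> i \<le> 2 * j \<and> even (i + j)}"
    let ?B = "(\<lambda>i. i + 2 * j) ` even_neg_row s t j"
    have "even_neg_row (s + 2 * t) t j = ?A \<union> ?B"
    proof (intro equalityI subsetI)
      fix i assume i: "i \<in> even_neg_row (s + 2 * t) t j"
      show "i \<in> ?A \<union> ?B"
      proof (cases "i \<le> 2 * j")
        case True
        then show ?thesis using i by (simp add: even_neg_row_def)
      next
        case False
        define k where "k = i - 2 * j"
        have "i = k + 2 * j" "k > 0" using False by (simp_all add: k_def)
        then have "k \<in> even_neg_row s t j"
          using i by (simp add: even_neg_row_def algebra_simps)
        with \<open>i = k + 2 * j\<close> show ?thesis by blast
      qed
    next
      fix i assume "i \<in> ?A \<union> ?B"
      then show "i \<in> even_neg_row (s + 2 * t) t j"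
      proof
        assume i: "i \<in> ?A"
        have "i * t \<le> 2 * j * t" using i by (intro mult_right_mono) auto
        moreover have "0 < j * s" using assms that by simp
        ultimately have "i * t < j * s + 2 * j * t" by linarith
        then have "i * t < j * (s + 2 * t)" by (simp add: algebra_simps)
        then show ?thesis using i by (simp add: even_neg_row_def)
      next
        assume "i \<in> ?B"
        then show ?thesis by (auto simp: even_neg_row_def algebra_simps)
      qed
    qed
    moreover have "card (?A \<union> ?B) = card ?A + card ?B"
    proof (rule card_Un_disjoint)
      show "finite ?A" by (rule finite_subset[of _ "{..2 * j}"]) auto
      show "finite ?B" using finite_even_neg_row assms by simp
      show "?A \<inter> ?B = {}" by (auto simp: even_neg_row_def)
    qed
    moreover have "card ?B = card (even_neg_row s t j)" by (simp add: card_image)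
    ultimately show ?thesis using card_same_parity_le_double[of j] by simp
  qed
  then show ?thesis using assms by (simp add: even_neg_eq_sum sum.distrib[symmetric])
qed

lemma mult_neq_mult_if_coprime:
  fixes i j s t :: nat
  assumes "coprime s t" "0 < j" "j < t"
  shows "i * t \<noteq> j * s"
proof
  assume "i * t = j * s"
  then have "t dvd j * s" by (metis dvd_triv_right)
  then have "t dvd j" using assms(1) by (simp add: coprime_dvd_mult_left_iff coprime_commute)
  then show False using assms dvd_imp_le by fastforce
qed

lemma sum_same_parity_less_double:
  "(\<Sum>j = 1..n. if even j then j - 1 else j) = (n * n + 1) div (2::nat)"
proof (induction n)
  case 0
  then show ?case by simp
next
  case (Suc n)
  show ?case
  proof (cases "even n")
    case True
    then obtain k where "n = 2 * k" by blast
    then show ?thesis using Suc by (simp add: algebra_simps)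
  next
    case False
    then obtain k where "n = 2 * k + 1" by (elim oddE)
    then show ?thesis using Suc by (simp add: algebra_simps)
  qed
qed

text \<open>
  In row \<open>j\<close> the reflection \<open>i \<mapsto> 2 j - i\<close> turns the points to the left of the line \<open>i t = j (2 t - s)\<close>
  into the points to the right of the line \<open>i t = j s\<close>.  Together with those to the left of that
  line they are all the points with \<open>0 < i < 2 j\<close> of the right parity.
\<close>

lemma even_neg_reflect:
  assumes "coprime s t" "0 < s" "s < 2 * t"
  shows "even_neg (2 * t - s) t + even_neg s t = (t div 2 * (t div 2) + 1) div 2"
proof -
  have "card (even_neg_row (2 * t - s) t j) + card (even_neg_row s t j)
      = (if even j then j - 1 else j)" if j: "j \<in> {1..t div 2}" for j
  proof -
    let ?A = "(\<lambda>i. 2 * j - i) ` even_neg_row (2 * t - s) t j"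
    let ?B = "even_neg_row s t j"
    let ?C = "{i. 0 < i \<and> i < 2 * j \<and> even (i + j)}"
    have lt: "i < 2 * j" if "i \<in> even_neg_row r t j" "r < 2 * t" for i r
    proof -
      have "j * r < j * (2 * t)" using j that by simp
      moreover have "i * t < j * r" using that(1) by (simp add: even_neg_row_def)
      ultimately have "i * t < 2 * j * t" by linarith
      then show ?thesis by simp
    qed
    have mirror: "i * t < j * (2 * t - s) \<longleftrightarrow> j * s < (2 * j - i) * t" if "i < 2 * j" for i
    proof -
      have "int (j * (2 * t - s)) = 2 * int j * int t - int j * int s"
        using assms by (simp add: of_nat_diff algebra_simps)
      moreover have "int ((2 * j - i) * t) = 2 * int j * int t - int i * int t"
        using that by (simp add: of_nat_diff algebra_simps)
      moreover have "int (i * t) = int i * int t" "int (j * s) = int j * int s" by simp_all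
      ultimately show ?thesis unfolding of_nat_less_iff[where 'a=int, symmetric] by linarith
    qed
    have rt: "2 * t - s < 2 * t" using assms by simp
    have "?A \<union> ?B = ?C"
    proof (intro equalityI subsetI)
      fix i assume "i \<in> ?A \<union> ?B"
      then show "i \<in> ?C"
      proof
        assume "i \<in> ?A"
        then obtain k where "i = 2 * j - k" "k \<in> even_neg_row (2 * t - s) t j" by blast
        with lt[OF this(2) rt] show ?thesis by (auto simp: even_neg_row_def)
      next
        assume "i \<in> ?B"
        with lt[OF this assms(3)] show ?thesis by (auto simp: even_neg_row_def)
      qed
    next
      fix i assume i: "i \<in> ?C"
      have "i * t \<noteq> j * s" using mult_neq_mult_if_coprime[OF assms(1)] j by auto
      then consider "i * t < j * s" | "j * s < i * t" by linarith
      then show "i \<in> ?A \<union> ?B"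
      proof cases
        case 1
        then show ?thesis using i by (simp add: even_neg_row_def)
      next
        case 2
        have "2 * j - i \<in> even_neg_row (2 * t - s) t j"
          using 2 i mirror[of "2 * j - i"] by (simp add: even_neg_row_def)
        moreover have "i = 2 * j - (2 * j - i)" using i by simp
        ultimately show ?thesis by blast
      qed
    qed
    moreover have "card (?A \<union> ?B) = card ?A + card ?B"
    proof (rule card_Un_disjoint)
      show "finite ?A" "finite ?B" using finite_even_neg_row assms by simp_all
      show "?A \<inter> ?B = {}"
      proof -
        have False if "i \<in> even_neg_row (2 * t - s) t j" "2 * j - i \<in> ?B" for i
          using that mirror[OF lt[OF that(1) rt]] by (simp add: even_neg_row_def)
        then show ?thesis by blast
      qed
    qed
    moreover have "card ?A = card (even_neg_row (2 * t - s) t j)"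
      using lt[OF _ rt] by (intro card_image inj_onI) (metis diff_diff_cancel less_imp_le)
    moreover have "card ?C = (if even j then j - 1 else j)"
    proof -
      have "{i. 0 < i \<and> i \<le> 2 * j \<and> even (i + j)} = ?C \<union> (if even j then {2 * j} else {})"
        using j by (auto simp: le_less)
      moreover have "finite ?C" by (rule finite_subset[of _ "{..2 * j}"]) auto
      ultimately show ?thesis
        using card_same_parity_le_double[of j] by (auto split: if_splits)
    qed
    ultimately show ?thesis by simp
  qed
  then have "(\<Sum>j = 1..t div 2. card (even_neg_row (2 * t - s) t j) + card (even_neg_row s t j))
      = (\<Sum>j = 1..t div 2. if even j then j - 1 else j)"
    by (intro sum.cong) auto
  moreover have "t > 0" using assms by simp
  ultimately show ?thesis
    unfolding even_neg_eq_sum[OF \<open>t > 0\<close>] sum.distrib sum_same_parity_less_double by simp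
qed

lemma card_even_cells_grid: "card (even_cells (grid m n)) = (m * n + 1) div 2"
proof -
  have row: "card {j \<in> {1..n}. even (i + j)} = (if even i then n div 2 else (n + 1) div 2)" for i
  proof (induction n)
    case (Suc n)
    have "{j \<in> {1..Suc n}. even (i + j)}
        = (if even (i + Suc n) then insert (Suc n) else id) {j \<in> {1..n}. even (i + j)}"
      by (auto simp: le_Suc_eq)
    then show ?case using Suc by (auto split: if_splits)
  qed simp
  have "even_cells (grid m n) = (SIGMA i:{1..m}. {j \<in> {1..n}. even (i + j)})"
    by (auto simp: even_cells_def grid_def)
  then have "card (even_cells (grid m n)) = (\<Sum>i = 1..m. if even i then n div 2 else (n + 1) div 2)"
    by (simp only: row[symmetric]) (rule card_SigmaI; simp)
  also have "\<dots> = (m * n + 1) div 2"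
  proof (induction m)
    case (Suc m)
    then show ?case by (cases "even m"; cases "even n") (auto elim!: evenE oddE simp: algebra_simps)
  qed simp
  finally show ?thesis .
qed

text \<open>
  No cell lies on the diagonal, so the two counts together run over all cells with \<open>i + j\<close> even.
\<close>

lemma even_neg_swap:
  assumes "coprime s t" "t > 0"
  shows "even_neg s t + even_neg t s = (s div 2 * (t div 2) + 1) div 2"
proof -
  let ?B = "prod.swap ` even_cells (neg_cells t s)"
  have "even_cells (grid (s div 2) (t div 2)) = even_cells (neg_cells s t) \<union> ?B"
  proof -
    have "i * t < j * s \<or> j * s < i * t" if "j \<in> {1..t div 2}" for i j
      using mult_neq_mult_if_coprime[OF assms(1), of j i] that by (auto simp: neq_iff)
    then show ?thesis
      by (fastforce simp: even_cells_def neg_cells_def grid_def image_iff add.commute)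
  qed
  moreover have "finite (even_cells (neg_cells a b))" for a b
    by (rule finite_subset[of _ "grid (a div 2) (b div 2)"])
      (auto simp: even_cells_def neg_cells_def)
  moreover have "even_cells (neg_cells s t) \<inter> ?B = {}"
    by (auto simp: even_cells_def neg_cells_def)
  ultimately show ?thesis
    using card_even_cells_grid[of "s div 2" "t div 2"]
    by (simp add: card_Un_disjoint card_image even_neg_def)
qed

text \<open>
  The exponent, with \<open>m = (s - 1) / 2\<close> and \<open>n = (t - 1) / 2\<close>, by which the parity of the lattice point
  count differs from the Jacobi symbol.  The three congruences below say that it changes
  under the three moves exactly as the comparison of count and symbol requires.
\<close>

definition sign_shift :: "nat \<Rightarrow> nat \<Rightarrow> nat" where
  "sign_shift m n = (if even n then m * n div 2 else if even m then 0 else (n + 1) div 2)"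


lemma sum_up_to: "(\<Sum>j = 1..n. j) = n * (n + 1) div (2::nat)"
  by (induction n) simp_all

lemma even_sign_shift_add:
  "even (sign_shift (m + (2 * n + 1)) n + sign_shift m n + (\<Sum>j = 1..n. j))"
proof (cases "even n")
  case True
  then obtain k where n: "n = 2 * k" by blast
  have *: "sign_shift m n = m * k" "sign_shift (m + (2 * n + 1)) n = (m + (4 * k + 1)) * k"
    "n * (n + 1) div 2 = k * (2 * k + 1)"
    by (simp_all add: n sign_shift_def)
  show ?thesis unfolding sum_up_to * by simp
next
  case False
  then obtain k where n: "n = 2 * k + 1" by (elim oddE)
  have "n * (n + 1) div 2 = (2 * k + 1) * (k + 1)" by (simp add: n)
  then show ?thesis unfolding sum_up_to by (simp add: sign_shift_def n)
qed

lemma even_sign_shift_reflect: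
  assumes "even m \<longleftrightarrow> even k"
  shows "even (sign_shift k n + sign_shift m n + (n * n + 1) div 2 + n)"
proof (cases "even n")
  case True
  then obtain l where n: "n = 2 * l" by blast
  then have "m * n div 2 = m * l" "k * n div 2 = k * l" "(n * n + 1) div 2 = 2 * l * l"
    by simp_all
  then show ?thesis using True assms by (simp add: sign_shift_def)
next
  case False
  then obtain l where n: "n = 2 * l + 1" by (elim oddE)
  have "(n * n + 1) div 2 = 2 * l * l + 2 * l + 1" by (simp add: n algebra_simps)
  then show ?thesis using False assms by (simp add: sign_shift_def)
qed

lemma even_sign_shift_swap:
  "even (sign_shift m n + sign_shift n m + (m * n + 1) div 2 + m * n)"
proof (cases "even m"; cases "even n")
  assume "even m" "even n"
  then obtain a b where "m = 2 * a" "n = 2 * b" by blast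
  then show ?thesis by (simp add: sign_shift_def)
next
  assume "even m" "odd n"
  then obtain a where "m = 2 * a" by blast
  then show ?thesis using \<open>odd n\<close> by (simp add: sign_shift_def)
next
  assume "odd m" "even n"
  then obtain a where "n = 2 * a" by blast
  then show ?thesis using \<open>odd m\<close> by (simp add: sign_shift_def)
next
  assume "odd m" "odd n"
  then obtain a b where m: "m = 2 * a + 1" and n: "n = 2 * b + 1" by (elim oddE)
  then have "(m * n + 1) div 2 = 2 * a * b + a + b + 1" by (simp add: algebra_simps)
  then show ?thesis using \<open>odd m\<close> \<open>odd n\<close> by (simp add: sign_shift_def m n)
qed

lemma Jacobi_swap:
  assumes "odd m" "odd n" "coprime m n"
  shows "Jacobi (int n) m = (-1) ^ (m div 2 * (n div 2)) * Jacobi (int m) n"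
proof -
  have "Jacobi (int m) n * Jacobi (int n) m = (-1) ^ (m div 2 * (n div 2))"
    using Jacobi_reciprocity[OF assms] .
  moreover from this have "\<bar>Jacobi (int m) n\<bar> = 1"
    by (metis abs_mult abs_neg_one abs_zmult_eq_1 power_abs power_one)
  ultimately show ?thesis by (auto simp: abs_if split: if_splits)
qed

text \<open>
  An analogue of Eisenstein's lattice point formula, restricted to points with even coordinate sum.
  The proof is a Euclidean descent on \<open>s + t\<close> through odd coprime pairs: the larger entry \<open>a\<close>
  is replaced by \<open>a - 2 b\<close> or, if \<open>a < 2 b\<close>, by \<open>2 b - a\<close>.
\<close>

theorem minus_one_power_even_neg:
  assumes "odd s" "odd t" "coprime s t"
  shows "(-1) ^ even_neg s t = (-1) ^ sign_shift (s div 2) (t div 2) * Jacobi (int s) t"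
  using assms
proof (induction "s + t" arbitrary: s t rule: less_induct)
  case less
  let ?K = "\<lambda>s t. sign_shift (s div 2) (t div 2)"
  let ?P = "\<lambda>s t. (-1) ^ even_neg s t = (-1) ^ ?K s t * Jacobi (int s) t"
  have step: "?P a b"
    if ab: "a + b = s + t" "b < a" "odd a" "odd b" "coprime a b" for a b
  proof -
    have pos: "0 < a" "0 < b" using ab by (auto intro: odd_pos)
    show ?thesis
    proof (cases "2 * b < a")
      case True
      define r where "r = a - 2 * b"
      have a: "a = r + 2 * b" "r > 0" using True by (simp_all add: r_def)
      have "coprime r b"
      proof (rule coprimeI)
        fix d assume "d dvd r" "d dvd b"
        then show "is_unit d" using coprime_common_divisor[OF ab(5)] by (simp add: a)
      qed
      then have IH: "?P r b" using ab a pos by (intro less.hyps) auto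
      have J: "Jacobi (int a) b = Jacobi (int r) b"
        unfolding a by (rule Jacobi_cong) (simp add: cong_iff_dvd_diff)
      have N: "even_neg a b = even_neg r b + (\<Sum>j = 1..b div 2. j)"
        using a pos even_neg_add_double[of r b] by simp
      have "a div 2 = r div 2 + (2 * (b div 2) + 1)" using \<open>odd b\<close> by (simp add: a)
      then have "even (?K a b + ?K r b + (\<Sum>j = 1..b div 2. j))"
        using even_sign_shift_add[of "r div 2" "b div 2"] by (simp only:)
      then have "(-1::int) ^ (?K r b + (\<Sum>j = 1..b div 2. j)) = (-1) ^ ?K a b"
        by (intro minus_one_power_cong) auto
      then show ?thesis using IH by (simp add: N J power_add mult_ac)
    next
      case False
      then have lt: "a < 2 * b" using ab by (metis dvd_triv_left linorder_neqE_nat)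
      define r where "r = 2 * b - a"
      have r: "odd r" "r < a" and a: "a = 2 * b - r"
        using lt ab by (auto simp: r_def)
      have "coprime r b"
      proof (rule coprimeI)
        fix d assume "d dvd r" "d dvd b"
        then have "d dvd a" by (simp add: a)
        then show "is_unit d" using \<open>d dvd b\<close> coprime_common_divisor[OF ab(5)] by blast
      qed
      then have IH: "?P r b" using ab r by (intro less.hyps) auto
      have "Jacobi (int r) b = Jacobi (-1 * int a) b"
        using lt by (intro Jacobi_cong) (auto simp: r_def cong_iff_dvd_diff of_nat_diff)
      then have J: "Jacobi (int r) b = (-1) ^ (b div 2) * Jacobi (int a) b"
        using Jacobi_mult_left[OF \<open>odd b\<close>, of "-1" "int a"] Jacobi_minus_one[OF \<open>odd b\<close>]
        by metis
      let ?Q = "(b div 2 * (b div 2) + 1) div 2"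
      have N: "even_neg r b + even_neg a b = ?Q"
        using even_neg_reflect[OF ab(5) pos(1) lt] by (simp add: r_def)
      have "even (a div 2) \<longleftrightarrow> even (r div 2)"
        using \<open>odd b\<close> \<open>odd a\<close> lt unfolding r_def by presburger
      from even_sign_shift_reflect[OF this, of "b div 2"]
      \<comment> \<open>The summand \<open>b div 2\<close> comes from the Jacobi symbol of \<open>-1\<close>, as \<open>r\<close> is \<open>- a\<close> modulo \<open>b\<close>.\<close>
      have K: "(-1::int) ^ (?Q + ?K r b + b div 2) = (-1) ^ ?K a b"
        by (intro minus_one_power_cong) auto
      have "(-1::int) ^ even_neg a b = (-1) ^ (?Q + even_neg r b)"
        unfolding N[symmetric] by (intro minus_one_power_cong) auto
      also have "\<dots> = (-1) ^ (?Q + ?K r b + b div 2) * Jacobi (int a) b"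
        using IH by (simp add: J power_add)
      finally show ?thesis unfolding K .
    qed
  qed
  consider "t < s" | "s < t" | "s = t" by linarith
  then show ?case
  proof cases
    case 1
    then show ?thesis using less.prems by (intro step) auto
  next
    case 2
    then have P: "?P t s" using less.prems by (intro step) (auto simp: coprime_commute)
    let ?m = "s div 2" and ?n = "t div 2"
    let ?Q = "(?m * ?n + 1) div 2"
    have N: "even_neg s t + even_neg t s = ?Q"
      using less.prems by (intro even_neg_swap) (auto intro: odd_pos)
    have K: "(-1::int) ^ (?Q + ?K t s + ?m * ?n) = (-1) ^ ?K s t"
      using even_sign_shift_swap[of ?m ?n] by (intro minus_one_power_cong) auto
    have "(-1::int) ^ even_neg s t = (-1) ^ (?Q + even_neg t s)"
      unfolding N[symmetric] by (intro minus_one_power_cong) auto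
    also have "\<dots> = (-1) ^ (?Q + ?K t s + ?m * ?n) * Jacobi (int s) t"
      using P Jacobi_swap[OF less.prems] by (simp add: power_add)
    finally show ?thesis unfolding K .
  next
    case 3
    then have "s = 1" "t = 1" using less.prems by auto
    then show ?thesis by (simp add: even_neg_eq_sum sign_shift_def)
  qed
qed

section \<open>Weighted staircases\<close>

text \<open>
  The regions of an \<open>m \<times> n\<close> box on one side of a monotone lattice path: with every cell they contain the
  cells of smaller \<open>i\<close> and larger \<open>j\<close>.
\<close>

definition staircases :: "nat \<Rightarrow> nat \<Rightarrow> (nat \<times> nat) set set" where
  "staircases m n = {D. D \<subseteq> grid m n \<and>
     (\<forall>i j i' j'. (i, j) \<in> D \<longrightarrow> (i', j') \<in> grid m n \<longrightarrow> i' \<le> i \<longrightarrow> j \<le> j' \<longrightarrow> (i', j') \<in> D)}"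

definition staircase_sum :: "(nat \<times> nat \<Rightarrow> 'a::comm_semiring_1) \<Rightarrow> nat \<Rightarrow> nat \<Rightarrow> 'a" where
  "staircase_sum f m n = (\<Sum>D\<in>staircases m n. prod f D)"

lemma staircasesD:
  assumes "D \<in> staircases m n"
  shows "D \<subseteq> grid m n"
    and "(i, j) \<in> D \<Longrightarrow> (i', j') \<in> grid m n \<Longrightarrow> i' \<le> i \<Longrightarrow> j \<le> j' \<Longrightarrow> (i', j') \<in> D"
  using assms by (auto simp: staircases_def)

lemma staircasesI:
  assumes "D \<subseteq> grid m n"
    and "\<And>i j i' j'. (i, j) \<in> D \<Longrightarrow> (i', j') \<in> grid m n \<Longrightarrow> i' \<le> i \<Longrightarrow> j \<le> j' \<Longrightarrow> (i', j') \<in> D"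
  shows "D \<in> staircases m n"
  using assms by (auto simp: staircases_def)

lemma finite_staircases [simp, intro]: "finite (staircases m n)"
  by (rule finite_subset[of _ "Pow (grid m n)"]) (auto simp: staircases_def)

lemma staircase_sum_0 [simp]:
  "staircase_sum f 0 n = 1" "staircase_sum f m 0 = 1"
proof -
  have "staircases 0 n = {{}}" "staircases m 0 = {{}}"
    by (auto simp: staircases_def grid_def)
  then show "staircase_sum f 0 n = 1" "staircase_sum f m 0 = 1"
    by (simp_all add: staircase_sum_def)
qed

text \<open>
  If the corner cell \<open>(m + 1, n + 1)\<close> is missing then its column is empty; if it is present then its row
  is full.
\<close>

lemma staircases_Suc_Suc:
  "staircases (Suc m) (Suc n)
    = staircases m (Suc n) \<union> (\<lambda>D. {1..Suc m} \<times> {Suc n} \<union> D) ` staircases (Suc m) n"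
  (is "?S = ?A \<union> ?add_row ` ?B")
proof (intro equalityI subsetI)
  fix D assume D: "D \<in> ?S"
  show "D \<in> ?A \<union> ?add_row ` ?B"
  proof (cases "(Suc m, Suc n) \<in> D")
    case False
    have "(Suc m, j) \<notin> D" for j
    proof
      assume j: "(Suc m, j) \<in> D"
      then have "j \<le> Suc n" using staircasesD(1)[OF D] by (auto simp: grid_def)
      then have "(Suc m, Suc n) \<in> D"
        using staircasesD(2)[OF D j] by (auto simp: grid_def)
      with False show False by simp
    qed
    then have "D \<subseteq> grid m (Suc n)"
      using staircasesD(1)[OF D] by (fastforce simp: grid_def le_Suc_eq)
    then have "D \<in> ?A"
      using staircasesD(2)[OF D] by (intro staircasesI) (auto simp: grid_def)
    then show ?thesis by simp
  next
    case True
    have row: "{1..Suc m} \<times> {Suc n} \<subseteq> D"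
      using staircasesD(2)[OF D True] by (auto simp: grid_def)
    have "D \<inter> grid (Suc m) n \<in> ?B"
      using staircasesD(2)[OF D] by (intro staircasesI) (auto simp: grid_def)
    moreover have "D = ?add_row (D \<inter> grid (Suc m) n)"
      using row staircasesD(1)[OF D] by (fastforce simp: grid_def le_Suc_eq)
    ultimately show ?thesis by blast
  qed
next
  fix D assume "D \<in> ?A \<union> ?add_row ` ?B"
  then show "D \<in> ?S"
  proof
    assume D: "D \<in> ?A"
    show ?thesis
    proof (rule staircasesI)
      show "D \<subseteq> grid (Suc m) (Suc n)" using staircasesD(1)[OF D] by (auto simp: grid_def)
      fix i j i' j'
      assume *: "(i, j) \<in> D" "(i', j') \<in> grid (Suc m) (Suc n)" "i' \<le> i" "j \<le> j'"
      then have "i \<le> m" using staircasesD(1)[OF D] by (auto simp: grid_def)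
      then show "(i', j') \<in> D" using * by (intro staircasesD(2)[OF D *(1)]) (auto simp: grid_def)
    qed
  next
    assume "D \<in> ?add_row ` ?B"
    then obtain D' where D: "D = ?add_row D'" "D' \<in> ?B" by blast
    show ?thesis
    proof (rule staircasesI)
      show "D \<subseteq> grid (Suc m) (Suc n)"
        using staircasesD(1)[OF D(2)] by (auto simp: grid_def D(1))
      fix i j i' j'
      assume *: "(i, j) \<in> D" "(i', j') \<in> grid (Suc m) (Suc n)" "i' \<le> i" "j \<le> j'"
      show "(i', j') \<in> D"
      proof (cases "j' = Suc n")
        case True
        then show ?thesis using * by (auto simp: D(1) grid_def)
      next
        case False
        then have "(i', j') \<in> grid (Suc m) n" "(i, j) \<in> D'"
          using * by (auto simp: grid_def D(1))
        then show ?thesis using staircasesD(2)[OF D(2)] * by (auto simp: D(1))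
      qed
    qed
  qed
qed

text \<open>
  A weighted form of Pascal's rule; constant weight 1 counts staircases, and the weight
  \<open>chess_sign\<close> gives the signed count.
\<close>

lemma staircase_sum_Suc_Suc:
  "staircase_sum f (Suc m) (Suc n)
    = staircase_sum f m (Suc n) + (\<Prod>i = 1..Suc m. f (i, Suc n)) * staircase_sum f (Suc m) n"
proof -
  let ?row = "{1..Suc m} \<times> {Suc n}"
  let ?add_row = "\<lambda>D. ?row \<union> D"
  have outside: "D \<inter> ?row = {}" if "D \<in> staircases (Suc m) n" for D
    using staircasesD(1)[OF that] by (auto simp: grid_def)
  have fin: "finite D" if "D \<in> staircases k l" for D k l
    using staircasesD(1)[OF that] finite_subset by blast
  have "staircases m (Suc n) \<inter> ?add_row ` staircases (Suc m) n = {}"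
    by (fastforce dest: staircasesD(1) simp: grid_def)
  then have "staircase_sum f (Suc m) (Suc n)
      = staircase_sum f m (Suc n) + (\<Sum>D\<in>?add_row ` staircases (Suc m) n. prod f D)"
    unfolding staircase_sum_def staircases_Suc_Suc by (intro sum.union_disjoint) auto
  also have "(\<Sum>D\<in>?add_row ` staircases (Suc m) n. prod f D)
      = (\<Sum>D\<in>staircases (Suc m) n. prod f (?row \<union> D))"
  proof -
    have "inj_on ?add_row (staircases (Suc m) n)"
      using outside by (intro inj_onI) blast
    then show ?thesis by (simp add: sum.reindex)
  qed
  also have "\<dots> = (\<Sum>D\<in>staircases (Suc m) n. (\<Prod>i = 1..Suc m. f (i, Suc n)) * prod f D)"
  proof (intro sum.cong refl)
    fix D assume D: "D \<in> staircases (Suc m) n"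
    have "prod f (?row \<union> D) = prod f ?row * prod f D"
      using outside[OF D] fin[OF D] by (intro prod.union_disjoint) auto
    also have "prod f ?row = (\<Prod>i = 1..Suc m. f (i, Suc n))"
      by (rule prod.reindex_bij_witness[of _ "\<lambda>i. (i, Suc n)" fst]) auto
    finally show "prod f (?row \<union> D) = (\<Prod>i = 1..Suc m. f (i, Suc n)) * prod f D" .
  qed
  finally show ?thesis by (simp add: staircase_sum_def sum_distrib_left)
qed

lemma card_staircases: "card (staircases m n) = (m + n) choose m"
proof -
  have "staircase_sum (\<lambda>_. 1::nat) m n = (m + n) choose m"
  proof (induction "m + n" arbitrary: m n)
    case (Suc k)
    show ?case
    proof (cases m)
      case (Suc m')
      show ?thesis
      proof (cases n)
        case (Suc n')
        then show ?thesis
          using Suc.hyps \<open>m = Suc m'\<close> by (simp add: staircase_sum_Suc_Suc)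
      qed simp
    qed simp
  qed simp
  then show ?thesis by (simp add: staircase_sum_def)
qed

definition chess_sign :: "nat \<times> nat \<Rightarrow> int" where
  "chess_sign c = (if even (fst c + snd c) then -1 else 1)"

lemma prod_chess_sign_row:
  "(\<Prod>i = 1..m. chess_sign (i, n)) = (-1) ^ ((if even n then m else Suc m) div 2)"
proof (induction m)
  case (Suc m)
  then show ?case by (auto simp: chess_sign_def elim!: evenE oddE)
qed (simp add: chess_sign_def)

text \<open>
  Only one step of the recursion is needed in each case.  If \<open>m\<close> and \<open>n\<close> are odd the two terms
  cancel, if exactly one is odd one of the terms vanishes, and if both are even the signs agree and
  Pascal's rule for the halves applies.
\<close>

theorem staircase_sum_chess_sign:
  "staircase_sum chess_sign m n =
     (if odd m \<and> odd n then 0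
      else (-1) ^ (if odd n then m div 2 else 0) * int ((m div 2 + n div 2) choose (m div 2)))"
proof (induction "m + n" arbitrary: m n rule: less_induct)
  case less
  show ?case
  proof (cases "m = 0 \<or> n = 0")
    case False
    then obtain k l where m: "m = Suc k" and n: "n = Suc l" by (meson not0_implies_Suc)
    have IH1: "staircase_sum chess_sign k (Suc l) =
       (if odd k \<and> even l then 0
        else (-1) ^ (if even l then k div 2 else 0) * int ((k div 2 + Suc l div 2) choose (k div 2)))"
      using less.hyps[of k "Suc l"] m n by simp
    have IH2: "staircase_sum chess_sign (Suc k) l =
       (if even k \<and> odd l then 0
        else (-1) ^ (if odd l then Suc k div 2 else 0) * int ((Suc k div 2 + l div 2) choose (Suc k div 2)))"
      using less.hyps[of "Suc k" l] m n by simp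
    show ?thesis
      unfolding m n staircase_sum_Suc_Suc IH1 IH2 prod_chess_sign_row
      by (cases "even k"; cases "even l") (auto elim!: evenE oddE)
  qed auto
qed

section \<open>Bar cores as staircases\<close>

text \<open>
  This is \<open>\<bar>i t - j s\<bar>\<close>: at least one of the two truncated differences is zero.
\<close>

definition cell_value :: "nat \<Rightarrow> nat \<Rightarrow> nat \<times> nat \<Rightarrow> nat" where
  "cell_value s t = (\<lambda>(i, j). (i * t - j * s) + (j * s - i * t))"

lemma eq_abs_diff_nat:
  fixes a b c d :: nat
  assumes "(a - b) + (b - a) = (c - d) + (d - c)"
  shows "a + d = c + b \<or> a + c = b + d"
  using assms by arith

text \<open>
  Here \<open>D\<close> lists the cells whose value \<open>i t - j s\<close> belongs to the set of integers that encodes the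
  partition.  A positive value is a part iff it belongs to that set; the negative of a negative value is
  a part iff the value does not belong to it.  Hence the symmetric difference.
\<close>

definition bar_of :: "nat \<Rightarrow> nat \<Rightarrow> (nat \<times> nat) set \<Rightarrow> nat set" where
  "bar_of s t D = cell_value s t ` ((D - neg_cells s t) \<union> (neg_cells s t - D))"

locale coprime_odd =
  fixes s t :: nat
  assumes s_gt_1: "s > 1" and t_gt_1: "t > 1" and odd_s: "odd s" and odd_t: "odd t"
    and coprime_s_t: "coprime s t"
begin

abbreviation "box \<equiv> grid (s div 2) (t div 2)"

lemma swapped: "coprime_odd t s"
  using s_gt_1 t_gt_1 odd_s odd_t coprime_s_t by unfold_locales (simp_all add: coprime_commute)

text \<open>
  A residue class modulo \<open>s\<close> determines the column, as \<open>t\<close> is invertible modulo \<open>s\<close>.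
\<close>

lemma column_unique:
  assumes "i * t + x * s = k * t + y * s" "i < s" "k < s"
  shows "i = k"
proof -
  have "[i * t = k * t] (mod s)"
    using assms(1) by (metis cong_def mod_mult_self1)
  then have "[i = k] (mod s)"
    using coprime_s_t by (simp add: cong_mult_rcancel_nat coprime_commute)
  then show ?thesis using assms by (simp add: cong_def)
qed

text \<open>
  Since \<open>i\<close> stays below \<open>s / 2\<close>, two columns of the box never represent opposite residue classes
  modulo \<open>s\<close>.
\<close>

lemma columns_not_opposite:
  assumes "(i + k) * t = x * s" "0 < i" "i \<le> s div 2" "k \<le> s div 2"
  shows False
proof -
  have "i + k < s" using assms odd_s by (auto elim!: oddE)
  then have "i + k = 0"
    using column_unique[of "i + k" 0 0 x] assms(1) by simp
  then show False using assms by simp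
qed

lemma box_not_diagonal:
  assumes "(i, j) \<in> box"
  shows "i * t \<noteq> j * s"
  using assms coprime_s_t t_gt_1 by (intro mult_neq_mult_if_coprime) (auto simp: grid_def)

lemma inj_on_cell_value: "inj_on (cell_value s t) box"
proof (rule inj_onI, clarify)
  fix i j k l
  assume ij: "(i, j) \<in> box" and kl: "(k, l) \<in> box"
    and eq: "cell_value s t (i, j) = cell_value s t (k, l)"
  have "i * t + l * s = k * t + j * s \<or> i * t + k * t = j * s + l * s"
    using eq unfolding cell_value_def prod.case by (rule eq_abs_diff_nat)
  then show "i = k \<and> j = l"
  proof
    assume *: "i * t + l * s = k * t + j * s"
    have "i < s" "k < s" using ij kl s_gt_1 by (auto simp: grid_def)
    then have "i = k" using column_unique[OF *] by blast
    then show ?thesis using * s_gt_1 by simp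
  next
    assume "i * t + k * t = j * s + l * s"
    then have "(i + k) * t = (j + l) * s" by (simp add: algebra_simps)
    then show ?thesis using columns_not_opposite ij kl by (auto simp: grid_def)
  qed
qed

lemma mem_bar_of_iff:
  assumes "D \<subseteq> box"
  shows "a \<in> bar_of s t D \<longleftrightarrow> a > 0 \<and>
    (\<exists>i j. (i, j) \<in> box \<and> (if (i, j) \<in> D then a + j * s = i * t else a + i * t = j * s))"
    (is "_ \<longleftrightarrow> ?R")
proof
  assume "a \<in> bar_of s t D"
  then obtain i j where c: "(i, j) \<in> (D - neg_cells s t) \<union> (neg_cells s t - D)"
    and a: "a = cell_value s t (i, j)" by (auto simp: bar_of_def)
  have ij: "(i, j) \<in> box" using c assms neg_cells_subset_grid by blast
  then have neq: "i * t \<noteq> j * s" by (rule box_not_diagonal)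
  show ?R
  proof (cases "(i, j) \<in> D")
    case True
    then have "j * s < i * t" using c ij neq by (auto simp: neg_cells_def)
    then have "a > 0 \<and> a + j * s = i * t" by (simp add: a cell_value_def)
    then show ?thesis using ij True by auto
  next
    case False
    then have "i * t < j * s" using c by (auto simp: neg_cells_def)
    then have "a > 0 \<and> a + i * t = j * s" by (simp add: a cell_value_def)
    then show ?thesis using ij False by auto
  qed
next
  assume ?R
  then obtain i j where ij: "(i, j) \<in> box" "a > 0"
    and a: "if (i, j) \<in> D then a + j * s = i * t else a + i * t = j * s" by blast
  have "a = cell_value s t (i, j)"
    using a unfolding cell_value_def prod.case by (auto split: if_splits)
  moreover have "(i, j) \<in> (D - neg_cells s t) \<union> (neg_cells s t - D)"
    using a ij by (auto simp: neg_cells_def split: if_splits)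
  ultimately show "a \<in> bar_of s t D" by (auto simp: bar_of_def)
qed

text \<open>
  Subtracting \<open>s\<close> from a part moves its cell by one step in its own column, towards the diagonal, and
  the staircase condition keeps the part present.  Two parts with sum \<open>s\<close> would have to come from
  vertically adjacent cells on opposite sides of the diagonal, one in \<open>D\<close> and one outside, in the
  order that the staircase condition forbids.
\<close>

lemma bar_core_bar_of:
  assumes D: "D \<in> staircases (s div 2) (t div 2)"
  shows "bar_core s (bar_of s t D)"
  unfolding bar_core_def
proof (intro conjI ballI impI)
  note sub = staircasesD(1)[OF D]
  note mem = mem_bar_of_iff[OF sub]
  have memI: "b \<in> bar_of s t D"
    if "(k, l) \<in> box" "b > 0" "if (k, l) \<in> D then b + l * s = k * t else b + k * t = l * s"
    for b k l
    using that mem by blast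
  have fin: "finite ((D - neg_cells s t) \<union> (neg_cells s t - D))"
    using sub neg_cells_subset_grid by (meson Diff_subset Un_least finite_grid finite_subset order_trans)
  show "bar_partition (bar_of s t D)"
    unfolding bar_partition_def using fin mem by (auto simp: bar_of_def)
  fix a assume a: "a \<in> bar_of s t D"
  obtain i j where ij: "(i, j) \<in> box" "a > 0"
    and a: "if (i, j) \<in> D then a + j * s = i * t else a + i * t = j * s"
    using a mem by blast
  show "\<not> s dvd a"
  proof
    assume "s dvd a"
    then have "s dvd i * t"
      using a by (metis dvd_add_left_iff dvd_add_right_iff dvd_triv_right)
    then obtain x where "(i + 0) * t = x * s" by (metis add_0_right dvdE mult.commute)
    then show False using columns_not_opposite[of i 0 x] ij by (auto simp: grid_def)
  qed
  {
    assume gt: "a > s"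
    show "a - s \<in> bar_of s t D"
    proof (cases "(i, j) \<in> D")
      case True
      then have eq: "a + j * s = i * t" using a by simp
      then have eq': "(a - s) + Suc j * s = i * t" using gt by simp
      then have "Suc j * s < i * t" using gt by linarith
      moreover have "i \<le> s div 2" using ij by (simp add: grid_def)
      ultimately have "Suc j \<le> t div 2" by (rule index_bound_if_neg)
      then have box: "(i, Suc j) \<in> box" using ij by (auto simp: grid_def)
      then have "(i, Suc j) \<in> D" using staircasesD(2)[OF D True] by simp
      then show ?thesis using eq' gt by (intro memI[OF box]) simp_all
    next
      case False
      then have eq: "a + i * t = j * s" using a by simp
      then have "s < j * s" using gt by linarith
      then have "j > 1" by simp
      then obtain j' where j': "j = Suc j'" "j' > 0" by (cases j) auto
      have eq': "(a - s) + i * t = j' * s" using eq gt by (simp add: j')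
      have box: "(i, j') \<in> box" using ij j' by (auto simp: grid_def)
      then have "(i, j') \<notin> D" using staircasesD(2)[OF D, of i j' i j] False ij j' by auto
      then show ?thesis using eq' gt by (intro memI[OF box]) simp_all
    qed
  next
    assume lt: "1 \<le> a \<and> a \<le> s - 1"
    show "s - a \<notin> bar_of s t D"
    proof
      assume "s - a \<in> bar_of s t D"
      then obtain k l where kl: "(k, l) \<in> box"
        and b: "if (k, l) \<in> D then (s - a) + l * s = k * t else (s - a) + k * t = l * s"
        using mem by blast
      have bounds: "0 < i" "i \<le> s div 2" "k \<le> s div 2" "i < s" "k < s"
        using ij kl s_gt_1 by (auto simp: grid_def)
      show False
      proof (cases "(i, j) \<in> D"; cases "(k, l) \<in> D")
        assume "(i, j) \<in> D" "(k, l) \<in> D"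
        then have "a + j * s = i * t" "(s - a) + l * s = k * t" using a b by auto
        then have "i * t + k * t = s + j * s + l * s" using lt by linarith
        then have "(i + k) * t = (1 + j + l) * s" by (simp add: algebra_simps)
        then show False using columns_not_opposite bounds by blast
      next
        assume ijD: "(i, j) \<in> D" and klD: "(k, l) \<notin> D"
        then have "a + j * s = i * t" "(s - a) + k * t = l * s" using a b by auto
        then have "i * t + l * s = k * t + (s + j * s)" using lt by linarith
        then have *: "i * t + l * s = k * t + Suc j * s" by simp
        then have "i = k" using bounds(4,5) by (rule column_unique)
        moreover have "l * s = Suc j * s" using * unfolding \<open>i = k\<close> by (rule add_left_imp_eq)
        then have "l = Suc j" using s_gt_1 by (metis mult_right_cancel not_less0)
        ultimately show False using staircasesD(2)[OF D ijD kl] klD by simp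
      next
        assume ijD: "(i, j) \<notin> D" and klD: "(k, l) \<in> D"
        then have "a + i * t = j * s" "(s - a) + l * s = k * t" using a b by auto
        then have "i * t + (s + l * s) = k * t + j * s" using lt by linarith
        then have *: "i * t + Suc l * s = k * t + j * s" by simp
        then have "i = k" using bounds(4,5) by (rule column_unique)
        moreover have "Suc l * s = j * s" using * unfolding \<open>i = k\<close> by (rule add_left_imp_eq)
        then have "j = Suc l" using s_gt_1 by (metis mult_right_cancel not_less0)
        ultimately show False using staircasesD(2)[OF D klD ij(1)] ijD by simp
      next
        assume "(i, j) \<notin> D" "(k, l) \<notin> D"
        then have "a + i * t = j * s" "(s - a) + k * t = l * s" using a b by auto
        then have "s + (i * t + k * t) = j * s + l * s" using lt by linarith
        then have "s + (i + k) * t = (j + l) * s" by (simp add: algebra_simps)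
        then have "(i + k) * t = (j + l - 1) * s" by (simp add: diff_mult_distrib)
        then show False using columns_not_opposite bounds by blast
      qed
    qed
  }
qed

text \<open>
  Exchanging \<open>s\<close> and \<open>t\<close> reverses the sign of \<open>i t - j s\<close>, so it transposes and complements the staircase.
  This carries the core property from \<open>s\<close> over to \<open>t\<close>.
\<close>

lemma bar_of_transpose:
  assumes "D \<subseteq> box"
  shows "bar_of s t D = bar_of t s (prod.swap ` (box - D))"
proof -
  interpret swap: coprime_odd t s by (rule swapped)
  have sub: "prod.swap ` (box - D) \<subseteq> swap.box" by (auto simp: grid_def)
  have "(j, i) \<in> swap.box \<and> (j, i) \<in> prod.swap ` (box - D) \<longleftrightarrow> (i, j) \<in> box \<and> (i, j) \<notin> D"
    "(j, i) \<in> swap.box \<longleftrightarrow> (i, j) \<in> box" for i j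
    by (force simp: grid_def)+
  then show ?thesis
    unfolding set_eq_iff mem_bar_of_iff[OF assms] swap.mem_bar_of_iff[OF sub] by metis
qed

lemma bar_core_bar_of_other:
  assumes D: "D \<in> staircases (s div 2) (t div 2)"
  shows "bar_core t (bar_of s t D)"
proof -
  interpret swap: coprime_odd t s by (rule swapped)
  have "prod.swap ` (box - D) \<in> staircases (t div 2) (s div 2)"
    using staircasesD(2)[OF D] by (intro staircasesI) (force simp: grid_def)+
  then show ?thesis
    using swap.bar_core_bar_of staircasesD(1)[OF D] by (simp add: bar_of_transpose)
qed

end

text \<open>
  The encoding of a bar partition by a set of integers that contains exactly one of \<open>x\<close> and \<open>-x\<close> for
  every nonzero \<open>x\<close>.  Counting \<open>0\<close> as a member expresses that no part of a core
  is a multiple of \<open>s\<close>, as subtracting \<open>s\<close> from \<open>0\<close> requires \<open>s\<close> not to be a part.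
\<close>

definition beads :: "nat set \<Rightarrow> int set" where
  "beads L = {x. x = 0 \<or> x > 0 \<and> nat x \<in> L \<or> x < 0 \<and> nat (- x) \<notin> L}"

lemma beads_uminus_iff: "x \<noteq> 0 \<Longrightarrow> - x \<in> beads L \<longleftrightarrow> x \<notin> beads L"
  by (auto simp: beads_def)

lemma beads_diff:
  assumes "bar_core s L" "s > 0" "x \<in> beads L"
  shows "x - int s \<in> beads L"
proof -
  have nd: "\<not> s dvd a" if "a \<in> L" for a using assms that by (auto simp: bar_core_def)
  have down: "a - s \<in> L" if "a \<in> L" "a > s" for a using assms that by (auto simp: bar_core_def)
  have opp: "s - a \<notin> L" if "a \<in> L" "1 \<le> a" "a \<le> s - 1" for a
    using assms that by (auto simp: bar_core_def)
  consider "x = 0" | "x > 0" "nat x \<in> L" | "x < 0" "nat (- x) \<notin> L"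
    using assms(3) by (auto simp: beads_def)
  then show ?thesis
  proof cases
    case 1
    then show ?thesis using nd[of s] assms(2) by (auto simp: beads_def)
  next
    case 2
    have "nat x \<noteq> s" using nd[OF 2(2)] by force
    then consider "nat x > s" | "nat x < s" by linarith
    then show ?thesis
    proof cases
      case 1
      then have "nat (x - int s) = nat x - s" "x - int s > 0" by auto
      then show ?thesis using down[OF 2(2) 1] by (simp add: beads_def)
    next
      case lt: 2
      then have "nat (- (x - int s)) = s - nat x" "x - int s < 0" using 2 by auto
      then show ?thesis using opp[OF 2(2)] lt 2 by (simp add: beads_def)
    qed
  next
    case 3
    have "nat (- (x - int s)) = nat (- x) + s" "x - int s < 0" using 3 by auto
    moreover have "nat (- x) + s \<notin> L" using down[of "nat (- x) + s"] 3 by auto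
    ultimately show ?thesis by (simp add: beads_def)
  qed
qed

lemma beads_diff_mult:
  assumes "bar_core s L" "s > 0" "x \<in> beads L"
  shows "x - int k * int s \<in> beads L"
proof (induction k)
  case (Suc k)
  have "x - int (Suc k) * int s = x - int k * int s - int s" by (simp add: algebra_simps)
  then show ?case using beads_diff[OF assms(1,2) Suc] by (simp only:)
qed (simp add: assms)


context coprime_odd
begin

text \<open>
  A part is written as \<open>a = i t - j s\<close> with \<open>\<bar>i\<bar> \<le> (s - 1) / 2\<close>.  If \<open>i > 0\<close>, then \<open>j \<le> 0\<close> would force the
  multiple \<open>i t\<close> of \<open>t\<close> to be a part.  If \<open>i < 0\<close>, then \<open>- j > (t - 1) / 2\<close> would, by closure, put
  \<open>(s + t) / 2\<close> into the encoding set, hence both of the opposite numbers \<open>(t - s) / 2\<close> and \<open>(s - t) / 2\<close>.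
\<close>

lemma bar_core_subset_cell_values:
  assumes "bar_core s L" "bar_core t L"
  shows "L \<subseteq> cell_value s t ` box"
proof
  fix a assume a: "a \<in> L"
  then have "a > 0" using assms by (auto simp: bar_core_def bar_partition_def)
  have down: "x - int k * int s - int l * int t \<in> beads L" if "x \<in> beads L" for x k l
    using beads_diff_mult[OF assms(1)] beads_diff_mult[OF assms(2)] s_gt_1 t_gt_1 that by simp
  have bead: "int a \<in> beads L" using a \<open>a > 0\<close> by (simp add: beads_def)
  have nd: "\<not> s dvd a" "\<not> t dvd b" if "b \<in> L" for b
    using a assms that by (auto simp: bar_core_def)
  obtain i0 where i0: "[int t * i0 = int a] (mod int s)"
    using cong_solve_coprime_int[of "int t" "int s"] coprime_s_t
    by (metis cong_scalar_left coprime_commute coprime_int_iff mult.assoc mult.commute mult_1)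
  \<comment> \<open>The representative of least absolute value is needed, so that \<open>\<bar>i\<bar>\<close> is a column of the box.\<close>
  define r where "r = i0 mod int s"
  define i where "i = (if r \<le> int (s div 2) then r else r - int s)"
  have r: "0 \<le> r" "r < int s" using s_gt_1 by (simp_all add: r_def)
  have s2: "int s = 2 * int (s div 2) + 1" using odd_s by presburger
  have t2: "int t = 2 * int (t div 2) + 1" using odd_t by presburger
  have i_bounds: "- int (s div 2) \<le> i" "i \<le> int (s div 2)"
    using r s2 by (auto simp: i_def)
  have "[i = i0] (mod int s)" by (auto simp: i_def r_def cong_def)
  then have "[i * int t = int a] (mod int s)"
    using i0 by (metis cong_scalar_left cong_trans mult.commute)
  then have "int s dvd i * int t - int a" by (simp add: cong_iff_dvd_diff)
  then obtain j where j: "i * int t - int a = int s * j" by (elim dvdE)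
  then have rep: "int a = i * int t - j * int s" by (simp add: algebra_simps)
  consider "i = 0" | "i > 0" | "i < 0" by linarith
  then show "a \<in> cell_value s t ` box"
  proof cases
    case 1
    then have "int s dvd int a" using rep by simp
    then show ?thesis using nd a by simp
  next
    case 2
    define k where "k = nat i"
    have k: "i = int k" "k > 0" "k \<le> s div 2" using 2 i_bounds by (auto simp: k_def)
    have "j > 0"
    proof (rule ccontr)
      assume "\<not> j > 0"
      define l where "l = nat (- j)"
      have l: "j = - int l" using \<open>\<not> j > 0\<close> by (simp add: l_def)
      have "int a - int l * int s - int 0 * int t \<in> beads L" by (rule down[OF bead])
      then have "int (k * t) \<in> beads L" using rep by (simp add: k l)
      then have "k * t \<in> L" using k t_gt_1 by (simp add: beads_def del: of_nat_mult)
      then have "\<not> t dvd k * t" by (rule nd(2))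
      then show False by simp
    qed
    define l where "l = nat j"
    have l: "j = int l" "l > 0" using \<open>j > 0\<close> by (simp_all add: l_def)
    have "int (a + l * s) = int (k * t)" using rep by (simp add: k l)
    then have eq: "a + l * s = k * t" by (simp only: of_nat_eq_iff)
    then have "l \<le> t div 2" using \<open>a > 0\<close> k by (intro index_bound_if_neg[of l s k t]) auto
    then have "(k, l) \<in> box" using k l by (simp add: grid_def)
    moreover have "cell_value s t (k, l) = a" using eq by (simp add: cell_value_def)
    ultimately show ?thesis by blast
  next
    case 3
    define k where "k = nat (- i)"
    have k: "i = - int k" "k > 0" "k \<le> s div 2" using 3 i_bounds by (auto simp: k_def)
    have "int a + int k * int t = (- j) * int s" using rep by (simp add: k)
    moreover have "0 < int a + int k * int t" using \<open>a > 0\<close> by (simp add: add_pos_nonneg)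
    ultimately have "0 < - j" using s_gt_1 by (simp add: mult_less_0_iff)
    define l where "l = nat (- j)"
    have l: "j = - int l" "l > 0" using \<open>0 < - j\<close> by (simp_all add: l_def)
    have "int (a + k * t) = int (l * s)" using rep by (simp add: k l)
    then have eq: "a + k * t = l * s" by (simp only: of_nat_eq_iff)
    have "l \<le> t div 2"
    proof (rule ccontr)
      assume gt: "\<not> l \<le> t div 2"
      define d where "d = (int t - int s) div 2"
      have d: "2 * d = int t - int s" using odd_s odd_t by (simp add: d_def)
      have "s \<noteq> t" using coprime_s_t s_gt_1 by auto
      then have "d \<noteq> 0" using d by auto
      \<comment> \<open>The value at \<open>(- (s div 2), - (t div 2 + 1))\<close>, which equals \<open>(s + t) / 2\<close>.\<close>
      define c where "c = int a - int (l - t div 2 - 1) * int s - int (s div 2 - k) * int t"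
      have "int a = int l * int s - int k * int t" using rep by (simp add: k l)
      moreover have "int (l - t div 2 - 1) = int l - int (t div 2) - 1"
        "int (s div 2 - k) = int (s div 2) - int k"
        using gt k by (simp_all add: of_nat_diff)
      ultimately have c: "c = (int (t div 2) + 1) * int s - int (s div 2) * int t"
        unfolding c_def by (simp add: algebra_simps)
      have "2 * c = (2 * int (t div 2) + 1) * int s + int s - 2 * int (s div 2) * int t"
        unfolding c by (simp add: algebra_simps)
      also have "2 * int (s div 2) = int s - 1" using s2 by simp
      also have "2 * int (t div 2) + 1 = int t" using t2 by simp
      finally have c2: "2 * c = int s + int t" by (simp add: algebra_simps)
      have cb: "c \<in> beads L" unfolding c_def by (rule down[OF bead])
      have "c - int s = d" "c - int t = - d" using c2 d by linarith+
      then have "d \<in> beads L" "- d \<in> beads L" using down[OF cb, of 1 0] down[OF cb, of 0 1] by simp_all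
      then show False using beads_uminus_iff[OF \<open>d \<noteq> 0\<close>] by simp
    qed
    then have "(k, l) \<in> box" using k l by (simp add: grid_def)
    moreover have "cell_value s t (k, l) = a" using eq by (simp add: cell_value_def)
    ultimately show ?thesis by blast
  qed
qed

lemma bar_core_is_bar_of:
  assumes "bar_core s L" "bar_core t L"
  shows "L \<in> bar_of s t ` staircases (s div 2) (t div 2)"
proof -
  define D where "D = {(i, j) \<in> box. int (i * t) - int (j * s) \<in> beads L}"
  have "D \<in> staircases (s div 2) (t div 2)"
  proof (rule staircasesI)
    show "D \<subseteq> box" by (auto simp: D_def)
    fix i j i' j'
    assume *: "(i, j) \<in> D" "(i', j') \<in> box" "i' \<le> i" "j \<le> j'"
    have "int (i * t) - int (j * s) \<in> beads L" using *(1) by (simp add: D_def)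
    then have "int (i * t) - int (j * s) - int (j' - j) * int s \<in> beads L"
      using s_gt_1 by (intro beads_diff_mult[OF assms(1)]) auto
    then have "int (i * t) - int (j * s) - int (j' - j) * int s - int (i - i') * int t \<in> beads L"
      using t_gt_1 by (intro beads_diff_mult[OF assms(2)]) auto
    also have "int (i * t) - int (j * s) - int (j' - j) * int s - int (i - i') * int t
        = int (i' * t) - int (j' * s)"
      using * by (simp add: of_nat_diff algebra_simps)
    finally show "(i', j') \<in> D" using * by (simp add: D_def)
  qed
  moreover have "bar_of s t D = L"
  proof -
    have "c \<in> (D - neg_cells s t) \<union> (neg_cells s t - D) \<longleftrightarrow> cell_value s t c \<in> L" if "c \<in> box" for c
    proof -
      obtain i j where c: "c = (i, j)" by fastforce
      have neq: "i * t \<noteq> j * s" using box_not_diagonal that c by simp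
      show ?thesis
      proof (cases "i * t < j * s")
        case True
        have "nat (int (j * s) - int (i * t)) = j * s - i * t" by linarith
        moreover have "int (i * t) - int (j * s) < 0" using True by linarith
        ultimately have "int (i * t) - int (j * s) \<in> beads L \<longleftrightarrow> j * s - i * t \<notin> L"
          unfolding beads_def by simp
        then show ?thesis
          using True that by (simp add: c D_def neg_cells_def cell_value_def)
      next
        case False
        have "nat (int (i * t) - int (j * s)) = i * t - j * s" by linarith
        moreover have "int (i * t) - int (j * s) > 0" using False neq by linarith
        ultimately have "int (i * t) - int (j * s) \<in> beads L \<longleftrightarrow> i * t - j * s \<in> L"
          unfolding beads_def by simp
        then show ?thesis
          using False that by (simp add: c D_def neg_cells_def cell_value_def)
      qed
    qed
    moreover have "(D - neg_cells s t) \<union> (neg_cells s t - D) \<subseteq> box"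
      using neg_cells_subset_grid by (auto simp: D_def)
    ultimately show ?thesis
      using bar_core_subset_cell_values[OF assms] unfolding bar_of_def by blast
  qed
  ultimately show ?thesis by blast
qed

lemma inj_on_bar_of: "inj_on (bar_of s t) (staircases (s div 2) (t div 2))"
proof (rule inj_onI)
  let ?N = "neg_cells s t"
  fix D E
  assume DE: "D \<in> staircases (s div 2) (t div 2)" "E \<in> staircases (s div 2) (t div 2)"
    and eq: "bar_of s t D = bar_of s t E"
  have "A - ?N \<union> (?N - A) \<subseteq> box" if "A \<in> staircases (s div 2) (t div 2)" for A
    using staircasesD(1)[OF that] neg_cells_subset_grid by blast
  then have "D - ?N \<union> (?N - D) = E - ?N \<union> (?N - E)"
    using eq DE inj_on_image_eq_iff[OF inj_on_cell_value] unfolding bar_of_def by meson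
  then show "D = E" by blast
qed

lemma bar_cores_eq:
  "{L. bar_core s L \<and> bar_core t L} = bar_of s t ` staircases (s div 2) (t div 2)"
  using bar_core_is_bar_of bar_core_bar_of bar_core_bar_of_other by blast

end

section \<open>The parity of the number of even parts\<close>

text \<open>
  The elements of the intersection enter the right-hand side only through the squares of their weights.
\<close>

lemma prod_symmetric_difference:
  fixes f :: "'a \<Rightarrow> 'b::comm_semiring_1"
  assumes "finite A" "finite B" "\<And>x. x \<in> A \<inter> B \<Longrightarrow> f x * f x = 1"
  shows "prod f ((A - B) \<union> (B - A)) = prod f A * prod f B"
proof -
  have "prod f A = prod f (A - B) * prod f (A \<inter> B)" "prod f B = prod f (B - A) * prod f (A \<inter> B)"
    using prod.Int_Diff[OF assms(1), of f B] prod.Int_Diff[OF assms(2), of f A]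
    by (simp_all add: Int_commute mult.commute)
  moreover have "prod f (A \<inter> B) * prod f (A \<inter> B) = 1"
    using assms(3) by (simp add: prod.distrib[symmetric])
  moreover have "prod f ((A - B) \<union> (B - A)) = prod f (A - B) * prod f (B - A)"
    using assms by (intro prod.union_disjoint) auto
  ultimately show ?thesis by (simp add: mult_ac)
qed

lemma prod_minus_one_if:
  assumes "finite A"
  shows "(\<Prod>x\<in>A. if P x then -1 else 1) = (-1 :: int) ^ card {x \<in> A. P x}"
  using assms by (simp add: prod.If_cases Int_def)

context coprime_odd
begin

lemma even_cell_value_iff: "even (cell_value s t (i, j)) \<longleftrightarrow> even (i + j)"
proof -
  have "even (i * t + j * s) \<longleftrightarrow> even (i + j)" using odd_s odd_t by auto
  moreover have "even ((a - b) + (b - a)) \<longleftrightarrow> even (a + b)" for a b :: nat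
    by presburger
  ultimately show ?thesis by (simp only: cell_value_def prod.case)
qed

lemma parity_bar_of:
  assumes D: "D \<in> staircases (s div 2) (t div 2)"
  shows "(-1) ^ card {a \<in> bar_of s t D. even a} = prod chess_sign D * (-1) ^ even_neg s t"
proof -
  let ?N = "neg_cells s t"
  let ?C = "(D - ?N) \<union> (?N - D)"
  have fin: "finite D" "finite ?N"
    using finite_subset[OF staircasesD(1)[OF D]] finite_subset[OF neg_cells_subset_grid[of s t]]
    by auto
  have sub: "?C \<subseteq> box" using staircasesD(1)[OF D] neg_cells_subset_grid by blast
  have "(-1) ^ card {a \<in> bar_of s t D. even a} = (\<Prod>a\<in>bar_of s t D. if even a then -1 else (1::int))"
    using fin by (intro prod_minus_one_if[symmetric]) (simp add: bar_of_def)
  also have "\<dots> = (\<Prod>c\<in>?C. if even (cell_value s t c) then -1 else 1)"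
    unfolding bar_of_def using inj_on_subset[OF inj_on_cell_value sub] by (subst prod.reindex) auto
  also have "\<dots> = prod chess_sign ?C"
    by (intro prod.cong refl) (auto simp: chess_sign_def even_cell_value_iff)
  also have "\<dots> = prod chess_sign D * prod chess_sign ?N"
    using fin by (intro prod_symmetric_difference) (auto simp: chess_sign_def)
  also have "prod chess_sign ?N = (-1) ^ even_neg s t"
  proof -
    have "even_cells ?N = {c \<in> ?N. even (fst c + snd c)}" by (auto simp: even_cells_def)
    then show ?thesis
      unfolding chess_sign_def prod_minus_one_if[OF fin(2)] even_neg_def by simp
  qed
  finally show ?thesis .
qed

lemma signed_sum_bar_cores:
  "(\<Sum>L | bar_core s L \<and> bar_core t L. (-1) ^ card {a \<in> L. even a})
     = (-1) ^ even_neg s t * staircase_sum chess_sign (s div 2) (t div 2)"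
  unfolding bar_cores_eq sum.reindex[OF inj_on_bar_of] staircase_sum_def sum_distrib_left
  by (intro sum.cong) (simp_all add: parity_bar_of mult.commute)

lemma card_bar_cores:
  "finite {L. bar_core s L \<and> bar_core t L}"
  "card {L. bar_core s L \<and> bar_core t L} = (s div 2 + t div 2) choose (s div 2)"
  unfolding bar_cores_eq by (simp_all add: card_image[OF inj_on_bar_of] card_staircases)

lemma twice_card_even_bar_cores:
  "2 * int (card {L. bar_core s L \<and> bar_core t L \<and> even_partition L})
     = int ((s div 2 + t div 2) choose (s div 2))
       + (-1) ^ even_neg s t * staircase_sum chess_sign (s div 2) (t div 2)"
proof -
  let ?S = "{L. bar_core s L \<and> bar_core t L}"
  have "int ((s div 2 + t div 2) choose (s div 2)) + (\<Sum>L\<in>?S. (-1) ^ card {a \<in> L. even a})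
      = (\<Sum>L\<in>?S. 1 + (-1) ^ card {a \<in> L. even a})"
    by (simp add: sum.distrib card_bar_cores)
  also have "\<dots> = (\<Sum>L\<in>?S. if even_partition L then 2 else 0)"
    by (intro sum.cong) (auto simp: even_partition_def)
  also have "\<dots> = 2 * int (card {L \<in> ?S. even_partition L})"
    using card_bar_cores(1) by (simp add: sum.If_cases Int_def)
  also have "{L \<in> ?S. even_partition L} = {L. bar_core s L \<and> bar_core t L \<and> even_partition L}"
    by auto
  finally show ?thesis by (simp add: signed_sum_bar_cores)
qed

end

theorem theorem1p1:
  fixes s t :: nat
  assumes "s > 1" and "t > 1" and "odd s" and "odd t" and "coprime s t"
  shows "([s = 3] (mod 4) \<and> [t = 3] (mod 4) \<longrightarrow>
           real (card {L. bar_core s L \<and> bar_core t L \<and> even_partition L}) =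
             1 / 2 * real (((s - 1) div 2 + (t - 1) div 2) choose ((s - 1) div 2))) \<and>
         (\<not> ([s = 3] (mod 4) \<and> [t = 3] (mod 4)) \<longrightarrow>
           real (card {L. bar_core s L \<and> bar_core t L \<and> even_partition L}) =
             1 / 2 * (real (((s - 1) div 2 + (t - 1) div 2) choose ((s - 1) div 2)) +
               (-1) ^ ((s - 1) * (t - 1) div 8) * real_of_int (Jacobi (int s) t) *
                 real ((s div 4 + t div 4) choose (t div 4))))"
proof -
  interpret coprime_odd s t using assms by unfold_locales
  let ?m = "s div 2" and ?n = "t div 2"
  let ?count = "card {L. bar_core s L \<and> bar_core t L \<and> even_partition L}"
  have half: "(s - 1) div 2 = ?m" "(t - 1) div 2 = ?n" using assms by presburger+
  have quarter: "?m div 2 = s div 4" "?n div 2 = t div 4" by simp_all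
  have mod4: "[s = 3] (mod 4) \<longleftrightarrow> odd ?m" "[t = 3] (mod 4) \<longleftrightarrow> odd ?n"
    using assms unfolding cong_def by presburger+
  have count: "real ?count = 1 / 2 * real_of_int (int ((?m + ?n) choose ?m)
      + (-1) ^ even_neg s t * staircase_sum chess_sign ?m ?n)"
    unfolding twice_card_even_bar_cores[symmetric] by simp
  show ?thesis
  proof (cases "odd ?m \<and> odd ?n")
    case True
    then show ?thesis unfolding count half mod4 by (simp add: staircase_sum_chess_sign)
  next
    case False
    have prod8: "(s - 1) * (t - 1) div 8 = ?m * ?n div 2"
    proof -
      have "s - 1 = 2 * ?m" "t - 1 = 2 * ?n" using assms by presburger+
      then have "(s - 1) * (t - 1) = 4 * (?m * ?n)" by simp
      then show ?thesis by simp
    qed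
    have sign: "(-1::int) ^ sign_shift ?m ?n * (-1) ^ (if odd ?n then ?m div 2 else 0)
        = (-1) ^ (?m * ?n div 2)"
    proof (cases "even ?n")
      case True
      then show ?thesis by (simp add: sign_shift_def)
    next
      case odd: False
      then obtain b where b: "?m = 2 * b" using False by blast
      then have "?m * ?n div 2 = b * ?n" by simp
      then show ?thesis using odd by (simp add: sign_shift_def b minus_one_power_iff)
    qed
    have "(-1) ^ even_neg s t * staircase_sum chess_sign ?m ?n
        = (-1) ^ (?m * ?n div 2) * Jacobi (int s) t * int ((?m div 2 + ?n div 2) choose (?m div 2))"
      unfolding sign[symmetric] minus_one_power_even_neg[OF assms(3-5)]
      using False by (auto simp: staircase_sum_chess_sign)
    also have "(?m div 2 + ?n div 2) choose (?m div 2) = (s div 4 + t div 4) choose (t div 4)"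
      unfolding quarter using binomial_symmetric[of "s div 4" "s div 4 + t div 4"] by simp
    finally show ?thesis unfolding count half mod4 prod8 using False by auto
  qed
qed

end
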